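(* For any constant $\delta>0$, any $k\le n^{1/2-\delta}$ and any $r>0$, at least $n^{\Omega(\log r)}$ queries to $\mathrm{VSTAT}(n^2/(rk^2))$ are required by any statistical algorithm to solve the distributional planted bipartite $k$-clique problem. In particular, no polynomial-time statistical algorithm can solve the problem using queries to $\mathrm{VSTAT}(o(n^2/k^2))$, and any statistical algorithm requires $n^{\Omega(\log n)}$ queries to $\mathrm{VSTAT}(n^{2-\delta}/k^2)$.
   Context: For $1\le k\le n$ and $S\subseteq\{1,\dots,n\}$ with $|S|=k$, let $D_S$ be the distribution on $\{0,1\}^n$ where with probability $1-k/n$ the vector $x$ is uniform on $\{0,1\}^n$, and with probability $k/n$ the coordinates in $S$ are set to $1$ and the remaining coordinates are uniform and independent. The distributional planted bipartite $k$-clique problem is the search problem: given access to an unknown $D_S$ (over all $k$-subsets $S$), find $S$. A statistical algorithm has no access to samples; it only (adaptively) submits query functions to an oracle and receives answers, and it solves the problem if for every $S$ and every sequence of answers permitted by the oracle it outputs $S$. The oracle $\mathrm{VSTAT}(t)$, given a query $h:\{0,1\}^n\to\{0,1\}$, returns any value $v\in[p-\tau,p+\tau]$ where $p=\mathbb{E}_{x\sim D_S}[h(x)]$ and $\tau=\max\{1/t,\sqrt{p(1-p)/t}\}$. *)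

theory Defs
  imports "HOL-Probability.Probability" "HOL-Library.Landau_Symbols"
begin

text \<open>A vector in \<open>{0,1}\<^sup>n\<close> is a function that is \<open>False\<close> outside \<open>{1..n}\<close>.\<close>

definition cube :: "nat \<Rightarrow> (nat \<Rightarrow> bool) set" where
  "cube n = PiE_dflt {1..n} False (\<lambda>_. UNIV)"

definition planted :: "nat \<Rightarrow> nat set \<Rightarrow> (nat \<Rightarrow> bool) pmf" where
  "planted n S =
     bind_pmf (bernoulli_pmf (real (card S) / real n))
       (\<lambda>b. if b
            then Pi_pmf {1..n} False (\<lambda>i. if i \<in> S then return_pmf True else bernoulli_pmf (1/2))
            else pmf_of_set (cube n))"

text \<open>For \<open>t = 0\<close> the convention \<open>1 / 0 = 0\<close> would make this oracle exact; it is meant for \<open>t > 0\<close>.\<close>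

definition vstat :: "real \<Rightarrow> (nat \<Rightarrow> bool) pmf \<Rightarrow> ((nat \<Rightarrow> bool) \<Rightarrow> bool) \<Rightarrow> real set" where
  "vstat t D h =
     (let p = measure_pmf.expectation D (\<lambda>x. of_bool (h x));
          \<tau> = max (1 / t) (sqrt (p * (1 - p) / t))
      in {p - \<tau>..p + \<tau>})"

text \<open>
  A deterministic adaptive algorithm is a possibly non-terminating interaction tree:
  it outputs a set and stops, or performs one elementary step of internal computation, or submits
  a query and continues depending on the answer. What an internal step may do is unrestricted, so
  every concrete machine model with a query oracle is covered.
\<close>

codatatype stat_alg =
    Output "nat set"
  | Compute stat_alg
  | Query "(nat \<Rightarrow> bool) \<Rightarrow> bool" "real \<Rightarrow> stat_alg"

text \<open>
  A configuration consists of the remaining algorithm and the number of queries made so far;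
  \<open>v i\<close> is the answer to the query number \<open>i\<close>, counted from 0.
\<close>

definition step :: "(nat \<Rightarrow> real) \<Rightarrow> stat_alg \<times> nat \<Rightarrow> stat_alg \<times> nat" where
  "step v c = (case c of (A, q) \<Rightarrow>
     (case A of
        Output S \<Rightarrow> (A, q)
      | Compute A' \<Rightarrow> (A', q)
      | Query h f \<Rightarrow> (f (v q), Suc q)))"

definition config :: "(nat \<Rightarrow> real) \<Rightarrow> stat_alg \<Rightarrow> nat \<Rightarrow> stat_alg \<times> nat" where
  "config v A m = (step v ^^ m) (A, 0)"

definition permitted :: "real \<Rightarrow> (nat \<Rightarrow> bool) pmf \<Rightarrow> stat_alg \<Rightarrow> (nat \<Rightarrow> real) \<Rightarrow> bool" where
  "permitted t D A v \<longleftrightarrow> (\<forall>m h f q. config v A m = (Query h f, q) \<longrightarrow> v q \<in> vstat t D h)"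

definition ksubsets :: "nat \<Rightarrow> nat \<Rightarrow> nat set set" where
  "ksubsets n k = {S. S \<subseteq> {1..n} \<and> card S = k}"

definition solves :: "nat \<Rightarrow> nat \<Rightarrow> real \<Rightarrow> stat_alg \<Rightarrow> bool" where
  "solves n k t A \<longleftrightarrow>
     (\<forall>S \<in> ksubsets n k. \<forall>v. permitted t (planted n S) A v \<longrightarrow>
        (\<exists>m q. config v A m = (Output S, q)))"

text \<open>The number of queries of an algorithm is the worst case over \<open>S\<close> and the permitted answers.\<close>

definition requires_queries :: "nat \<Rightarrow> nat \<Rightarrow> real \<Rightarrow> real \<Rightarrow> bool" where
  "requires_queries n k t Q \<longleftrightarrow>
     (\<forall>A. solves n k t A \<longrightarrow>
        (\<exists>S \<in> ksubsets n k. \<exists>v. permitted t (planted n S) A v \<and>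
           (\<exists>m. Q \<le> real (snd (config v A m)))))"

definition runs_in_time :: "nat \<Rightarrow> nat \<Rightarrow> real \<Rightarrow> stat_alg \<Rightarrow> nat \<Rightarrow> bool" where
  "runs_in_time n k t A T \<longleftrightarrow>
     (\<forall>S \<in> ksubsets n k. \<forall>v. permitted t (planted n S) A v \<longrightarrow>
        (\<exists>m \<le> T. \<exists>R q. config v A m = (Output R, q)))"

definition polynomial_time :: "(nat \<Rightarrow> nat) \<Rightarrow> (nat \<Rightarrow> real) \<Rightarrow> (nat \<Rightarrow> stat_alg) \<Rightarrow> bool" where
  "polynomial_time k t A \<longleftrightarrow>
     (\<exists>d. \<forall>\<^sub>F n in sequentially. runs_in_time n (k n) (t n) (A n) (n ^ d))"

end

theory Submission
  imports Defs
begin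

text \<open>
  The adversary answers every query \<open>h\<close> by its mean \<open>p\<close> under the uniform distribution. With
  \<open>bias S\<close> the relative density \<open>2\<^sup>k 1[x\<^sub>S = 1] - 1\<close>, the answer is
  wrong for \<open>S\<close> only if the correlation of \<open>h\<close> with \<open>bias S\<close> has square above
  \<open>r p (1 - p) / 2\<close>. Since \<open>bias S\<close> and \<open>bias T\<close> have inner product
  \<open>2\<^bsup>|S \<inter> T|\<^esup> - 1\<close>, Cauchy--Schwarz forces the sets eliminated by one query to have average
  \<open>2\<^bsup>|S \<inter> T|\<^esup> - 1\<close> at least \<open>r / 2\<close>. For \<open>k \<le> n\<^bsup>1/2 - \<delta>\<^esup>\<close> the
  moment of \<open>n\<^bsup>2 \<delta> |S \<inter> T|\<^esup>\<close> over random \<open>T\<close> is bounded, so pairs with an intersection of size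
  \<open>\<Omega>(log r)\<close> are so rare that a query eliminates at most an \<open>n\<^bsup>- \<Omega>(log r)\<^esup>\<close> fraction of all
  sets. Fewer queries than the inverse of this fraction leave two candidates.
\<close>

section \<open>Runs of an interaction tree against a sequence of answers\<close>

lemma snd_step_le: "snd c \<le> snd (step v c)"
  by (auto simp: step_def split: prod.splits stat_alg.splits)

lemma config_Suc: "config v A (Suc m) = step v (config v A m)"
  by (simp add: config_def)

lemma snd_config_mono: "m \<le> m' \<Longrightarrow> snd (config v A m) \<le> snd (config v A m')"
  by (rule lift_Suc_mono_le[of "\<lambda>m. snd (config v A m)"]) (simp_all add: config_Suc snd_step_le)

lemma snd_config_le: "snd (config v A m) \<le> m"
proof (induction m)
  case (Suc m)
  then show ?case
    by (auto simp: config_Suc step_def split: prod.splits stat_alg.splits)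
qed (simp add: config_def)

lemma config_Query_Suc:
  "config v A m = (Query h f, q) \<Longrightarrow> config v A (Suc m) = (f (v q), Suc q)"
  by (simp add: config_Suc step_def)

lemma config_Output_stable:
  assumes "config v A m = (Output S, q)" "m \<le> m'"
  shows "config v A m' = (Output S, q)"
  using assms(2,1) by (induction rule: dec_induct) (simp_all add: config_Suc step_def)

text \<open>Answering a query raises the counter for good, so no later configuration can pose a
  query under the same number.\<close>

lemma config_Query_unique:
  assumes "config v A m = (Query h f, q)" "config v A m' = (Query h' f', q)"
  shows "m = m'"
proof -
  have "\<not> m < m'" if "config v A m = (Query h f, q)" "config v A m' = (Query h' f', q)"
    for m m' h f h' f'
  proof
    assume "m < m'"
    then have "snd (config v A (Suc m)) \<le> snd (config v A m')"
      by (intro snd_config_mono) simp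
    then show False
      using config_Query_Suc[OF that(1)] that(2) by simp
  qed
  from this[OF assms] this[OF assms(2,1)] show ?thesis by simp
qed

text \<open>The answer may depend on the query posed, whereas \<open>step\<close> reads a sequence
  fixed in advance.\<close>

definition strategy_step ::
  "(nat \<Rightarrow> ((nat \<Rightarrow> bool) \<Rightarrow> bool) \<Rightarrow> real) \<Rightarrow> stat_alg \<times> nat \<Rightarrow> stat_alg \<times> nat" where
  "strategy_step g c = (case c of (A, q) \<Rightarrow>
     (case A of
        Output S \<Rightarrow> (A, q)
      | Compute A' \<Rightarrow> (A', q)
      | Query h f \<Rightarrow> (f (g q h), Suc q)))"

text \<open>The run against \<open>g\<close> poses at most one query per number, so its answers can
  be read off as a sequence \<open>v\<close>, and the run on \<open>v\<close> is that same run. This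
  turns a strategy into a sequence of which \<open>permitted\<close> can speak.\<close>

lemma strategy_answers_exist:
  "\<exists>v. \<forall>m h f q. config v A m = (Query h f, q) \<longrightarrow> v q = g q h"
proof -
  define C where "C m = (strategy_step g ^^ m) (A, 0)" for m
  have C_Suc: "C (Suc m) = strategy_step g (C m)" for m
    by (simp add: C_def)
  have mono: "snd (C m) \<le> snd (C m')" if "m \<le> m'" for m m'
    using that
    by (rule lift_Suc_mono_le[of "\<lambda>m. snd (C m)", rotated])
      (auto simp: C_Suc strategy_step_def split: prod.splits stat_alg.splits)
  have not_less: "\<not> m < m'" if "C m = (Query h f, q)" "C m' = (Query h' f', q)"
    for m m' h f h' f' q
  proof
    assume "m < m'"
    then have "snd (C (Suc m)) \<le> snd (C m')"
      by (intro mono) simp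
    then show False
      using that by (simp add: C_Suc strategy_step_def)
  qed
  have unique: "h = h'" if "C m = (Query h f, q)" "C m' = (Query h' f', q)" for m m' h f h' f' q
  proof -
    have "m = m'"
      using not_less[OF that] not_less[OF that(2,1)] by simp
    then show ?thesis using that by simp
  qed
  define v where "v q = g q (THE h. \<exists>m f. C m = (Query h f, q))" for q
  have v: "v q = g q h" if "C m = (Query h f, q)" for m h f q
  proof -
    have "(THE h. \<exists>m f. C m = (Query h f, q)) = h"
      using that unique by (intro the_equality) blast+
    then show ?thesis by (simp add: v_def)
  qed
  have "config v A m = C m" for m
  proof (induction m)
    case (Suc m)
    obtain B q where B: "C m = (B, q)" by force
    show ?case
      using v[of m _ _ q] Suc B
      by (cases B) (simp_all add: config_Suc C_Suc step_def strategy_step_def)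
  qed (simp add: config_def C_def)
  then have "\<forall>m h f q. config v A m = (Query h f, q) \<longrightarrow> v q = g q h"
    using v by simp
  then show ?thesis by (rule exI[of _ v])
qed

text \<open>A configuration with counter at most \<open>b\<close> has consumed only answers numbered
  below \<open>b\<close>.\<close>

lemma config_cong_prefix:
  assumes agree: "\<And>m h f q. config v A m = (Query h f, q) \<Longrightarrow> q < b \<Longrightarrow> v' q = v q"
    and "snd (config v A m) \<le> b"
  shows "config v' A m = config v A m"
  using assms(2)
proof (induction m)
  case (Suc m)
  have "snd (config v A m) \<le> b"
    using Suc.prems snd_config_mono[of m "Suc m" v A] by simp
  then have IH: "config v' A m = config v A m" by (rule Suc.IH)
  obtain B q where B: "config v A m = (B, q)" by force
  show ?case
    using agree[of m _ _ q] Suc.prems IH B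
    by (cases B) (simp_all add: config_Suc step_def)
qed (simp add: config_def)

section \<open>The adversary argument\<close>

lemma expectation_in_vstat:
  "t > 0 \<Longrightarrow> measure_pmf.expectation D (\<lambda>x. of_bool (h x)) \<in> vstat t D h"
  by (simp add: vstat_def Let_def le_max_iff_disj)

lemma finite_ksubsets: "finite (ksubsets n k)"
  by (rule finite_subset[of _ "Pow {1..n}"]) (auto simp: ksubsets_def)

lemma card_ksubsets: "card (ksubsets n k) = n choose k"
  using n_subsets[of "{1..n}" k] by (simp add: ksubsets_def)

text \<open>Each answer \<open>a h\<close> is inadmissible for at most \<beta> sets, so two sets
  survive \<open>b\<close> answers. An algorithm that never went beyond \<open>b\<close> queries
  would have to output both.\<close>

lemma adversary_forces_queries:
  fixes a :: "((nat \<Rightarrow> bool) \<Rightarrow> bool) \<Rightarrow> real"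
  assumes "t > 0" and solves: "solves n k t A"
    and few: "\<And>h. real (card {S \<in> ksubsets n k. a h \<notin> vstat t (planted n S) h}) \<le> \<beta>"
    and room: "real b * \<beta> + 2 \<le> real (card (ksubsets n k))"
  shows "\<exists>S \<in> ksubsets n k. \<exists>v. permitted t (planted n S) A v \<and> (\<exists>m. b < snd (config v A m))"
proof -
  let ?K = "ksubsets n k"
  define bad where "bad h = {S \<in> ?K. a h \<notin> vstat t (planted n S) h}" for h
  obtain v where v: "\<And>m h f q. config v A m = (Query h f, q) \<Longrightarrow> v q = a h"
    using strategy_answers_exist[of A "\<lambda>_ h. a h"] by blast
  define H where "H q = (THE h. \<exists>m f. config v A m = (Query h f, q))" for q
  have H: "H q = h" if "config v A m = (Query h f, q)" for m h f q
    unfolding H_def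
  proof (rule the_equality)
    show "\<exists>m f. config v A m = (Query h f, q)" using that by blast
  next
    fix h' assume "\<exists>m f. config v A m = (Query h' f, q)"
    then obtain m' f' where *: "config v A m' = (Query h' f', q)" by blast
    with config_Query_unique[OF that *] that show "h' = h" by simp
  qed
  \<comment> \<open>The sets ruled out by the first \<open>b\<close> answers. If fewer queries are
    posed, the remaining \<open>H i\<close> are arbitrary, which is harmless because
    \<open>few\<close> covers every \<open>h\<close>.\<close>
  define E where "E = (\<Union>i<b. bad (H i))"
  have "real (card E) \<le> (\<Sum>i<b. real (card (bad (H i))))"
    unfolding E_def using card_UN_le[of "{..<b}" "\<lambda>i. bad (H i)"]
    by (simp flip: of_nat_sum)
  also have "\<dots> \<le> (\<Sum>i<b. \<beta>)"
    by (intro sum_mono) (use few bad_def in auto)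
  finally have "real (card E) + 2 \<le> real (card ?K)"
    using room by simp
  moreover have "E \<subseteq> ?K"
    by (auto simp: E_def bad_def)
  ultimately have "2 \<le> card (?K - E)"
    using finite_ksubsets[of n k] by (subst card_Diff_subset) (auto intro: finite_subset)
  then obtain P where "P \<subseteq> ?K - E" "card P = 2"
    by (rule obtain_subset_with_card_n)
  then obtain S T where ST: "S \<in> ?K - E" "T \<in> ?K - E" "S \<noteq> T"
    by (auto simp: card_2_iff)
  have ok: "v q \<in> vstat t (planted n R) h"
    if "config v A m = (Query h f, q)" "q < b" "R \<in> ?K - E" for m h f q R
    using that H[OF that(1)] v[OF that(1)] by (auto simp: E_def bad_def)
  \<comment> \<open>Otherwise \<open>v\<close> is permitted for every survivor, and one run would
    end with both \<open>S\<close> and \<open>T\<close>.\<close>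
  have "\<exists>m. b < snd (config v A m)"
  proof (rule ccontr)
    assume "\<nexists>m. b < snd (config v A m)"
    then have le: "snd (config v A m) \<le> b" for m
      by (meson not_less)
    have perm: "permitted t (planted n R) A v" if "R \<in> ?K - E" for R
      unfolding permitted_def
    proof (intro allI impI)
      fix m h f q assume *: "config v A m = (Query h f, q)"
      show "v q \<in> vstat t (planted n R) h"
        using ok[OF * _ that] config_Query_Suc[OF *] le[of "Suc m"] by simp
    qed
    have "\<exists>m q. config v A m = (Output R, q)" if "R \<in> ?K - E" for R
      using solves perm[OF that] that unfolding solves_def by blast
    from this[OF ST(1)] this[OF ST(2)]
    obtain m q m' q' where "config v A m = (Output S, q)" "config v A m' = (Output T, q')"
      by blast
    then have "config v A (max m m') = (Output S, q)" "config v A (max m m') = (Output T, q')"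
      by (auto intro: config_Output_stable)
    with \<open>S \<noteq> T\<close> show False by simp
  qed
  then obtain m where m: "b < snd (config v A m)" by blast
  \<comment> \<open>From number \<open>b\<close> on, \<open>a h\<close> may be inadmissible for
    \<open>S\<close>, so the answers switch to the exact mean under \<open>S\<close>. The earlier
    answers stay, so the run still passes \<open>b\<close> queries.\<close>
  define p where "p h = measure_pmf.expectation (planted n S) (\<lambda>x. of_bool (h x) :: real)" for h
  obtain v' where v': "\<And>m h f q. config v' A m = (Query h f, q) \<Longrightarrow>
      v' q = (if q < b then v q else p h)"
    using strategy_answers_exist[of A "\<lambda>q h. if q < b then v q else p h"] by blast
  have eq: "config v A m = config v' A m" if "snd (config v' A m) \<le> b" for m
  proof (rule config_cong_prefix[OF _ that])
    show "v q = v' q" if "config v' A m = (Query h f, q)" "q < b" for m h f q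
      using v'[OF that(1)] that(2) by simp
  qed
  have "permitted t (planted n S) A v'"
    unfolding permitted_def
  proof (intro allI impI)
    fix m h f q assume *: "config v' A m = (Query h f, q)"
    show "v' q \<in> vstat t (planted n S) h"
    proof (cases "q < b")
      case True
      then have "config v A m = (Query h f, q)"
        using eq[of m] * by simp
      from ok[OF this True ST(1)] show ?thesis
        using v'[OF *] True by simp
    next
      case False
      then show ?thesis
        using v'[OF *] expectation_in_vstat[OF \<open>t > 0\<close>] by (simp add: p_def)
    qed
  qed
  moreover have "\<exists>m. b < snd (config v' A m)"
    using m eq[of m] by (metis not_less)
  ultimately show ?thesis using ST(1) by blast
qed

section \<open>Uniform averages over the cube and the relative density of a planted set\<close>

definition cube_avg :: "nat \<Rightarrow> ((nat \<Rightarrow> bool) \<Rightarrow> real) \<Rightarrow> real" where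
  "cube_avg n f = (\<Sum>x\<in>cube n. f x) / 2 ^ n"

definition bias :: "nat set \<Rightarrow> (nat \<Rightarrow> bool) \<Rightarrow> real" where
  "bias S x = 2 ^ card S * of_bool (\<forall>i\<in>S. x i) - 1"

lemma finite_cube: "finite (cube n)"
  by (auto simp: cube_def)

text \<open>As a product set, the subcube can be counted factor by factor and recognised as the
  support of a product distribution.\<close>

lemma subcube_eq:
  "S \<subseteq> {1..n} \<Longrightarrow>
     {x \<in> cube n. \<forall>i\<in>S. x i} = PiE_dflt {1..n} False (\<lambda>i. if i \<in> S then {True} else UNIV)"
  by (auto simp: cube_def PiE_dflt_def split: if_splits)

lemma card_subcube:
  assumes "S \<subseteq> {1..n}"
  shows "card {x \<in> cube n. \<forall>i\<in>S. x i} * 2 ^ card S = 2 ^ n"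
proof -
  have "card {x \<in> cube n. \<forall>i\<in>S. x i} = (\<Prod>i\<in>{1..n}. if i \<in> S then 1 else 2)"
    using assms by (simp add: subcube_eq card_PiE_dflt if_distrib cong: if_cong)
  also have "\<dots> = 2 ^ card ({1..n} - S)"
    by (simp add: prod.If_cases Diff_eq)
  also have "card ({1..n} - S) = n - card S"
    using assms by (simp add: card_Diff_subset finite_subset)
  finally show ?thesis
    using card_mono[OF _ assms] by (simp flip: power_add)
qed

lemma card_cube: "card (cube n) = 2 ^ n"
  using card_subcube[of "{}" n] by simp

lemma cube_avg_add: "cube_avg n (\<lambda>x. f x + g x) = cube_avg n f + cube_avg n g"
  by (simp add: cube_avg_def sum.distrib add_divide_distrib)

lemma cube_avg_diff: "cube_avg n (\<lambda>x. f x - g x) = cube_avg n f - cube_avg n g"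
  by (simp add: cube_avg_def sum_subtractf diff_divide_distrib)

lemma cube_avg_cmult: "cube_avg n (\<lambda>x. c * f x) = c * cube_avg n f"
  by (simp add: cube_avg_def flip: sum_distrib_left)

lemma cube_avg_const: "cube_avg n (\<lambda>_. c) = c"
  by (simp add: cube_avg_def card_cube)

lemma cube_avg_sum: "cube_avg n (\<lambda>x. \<Sum>i\<in>I. f i x) = (\<Sum>i\<in>I. cube_avg n (f i))"
  unfolding cube_avg_def by (subst sum.swap) (simp add: sum_divide_distrib)

lemma cube_avg_mono: "(\<And>x. f x \<le> g x) \<Longrightarrow> cube_avg n f \<le> cube_avg n g"
  by (simp add: cube_avg_def divide_right_mono sum_mono)

lemma cube_avg_Cauchy_Schwarz:
  "(cube_avg n (\<lambda>x. f x * g x))\<^sup>2 \<le> cube_avg n (\<lambda>x. (f x)\<^sup>2) * cube_avg n (\<lambda>x. (g x)\<^sup>2)"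
  using Cauchy_Schwarz_ineq_sum[of f g "cube n"]
  by (simp add: cube_avg_def power_divide power2_eq_square divide_right_mono)

lemma cube_avg_subcube:
  assumes "S \<subseteq> {1..n}"
  shows "2 ^ card S * cube_avg n (\<lambda>x. of_bool (\<forall>i\<in>S. x i)) = 1"
proof -
  have "(\<Sum>x\<in>cube n. of_bool (\<forall>i\<in>S. x i)) = real (card {x \<in> cube n. \<forall>i\<in>S. x i})"
    using finite_cube[of n] by (simp add: of_bool_def sum.If_cases Int_def)
  moreover have "real (card {x \<in> cube n. \<forall>i\<in>S. x i}) * 2 ^ card S = 2 ^ n"
    using arg_cong[OF card_subcube[OF assms], of real] by simp
  ultimately show ?thesis
    by (simp add: cube_avg_def field_simps)
qed

lemma cube_avg_bias: "S \<subseteq> {1..n} \<Longrightarrow> cube_avg n (bias S) = 0"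
  using cube_avg_subcube[of S n]
  by (simp add: bias_def[abs_def] cube_avg_diff cube_avg_cmult cube_avg_const)

text \<open>The product of the two indicators is the indicator of \<open>S \<union> T\<close>, and
  \<open>card S + card T - card (S \<union> T)\<close> is \<open>card (S \<inter> T)\<close>. The
  remaining terms contribute -1 - 1 + 1.\<close>

lemma cube_avg_bias_bias:
  assumes "S \<subseteq> {1..n}" "T \<subseteq> {1..n}"
  shows "cube_avg n (\<lambda>x. bias S x * bias T x) = 2 ^ card (S \<inter> T) - 1"
proof -
  have fin: "finite S" "finite T"
    using assms by (auto intro: finite_subset)
  define u :: "nat set \<Rightarrow> (nat \<Rightarrow> bool) \<Rightarrow> real" where "u R x = of_bool (\<forall>i\<in>R. x i)" for R x
  have u: "2 ^ card R * cube_avg n (u R) = 1" if "R \<subseteq> {1..n}" for R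
    using cube_avg_subcube[OF that] by (simp add: u_def[abs_def])
  have "bias S x * bias T x =
      2 ^ (card S + card T) * u (S \<union> T) x - 2 ^ card S * u S x - 2 ^ card T * u T x + 1" for x
    by (auto simp: bias_def u_def power_add algebra_simps)
  then have "cube_avg n (\<lambda>x. bias S x * bias T x) =
      2 ^ (card S + card T) * cube_avg n (u (S \<union> T)) - 1"
    using u assms
    by (simp add: cube_avg_add cube_avg_diff cube_avg_cmult cube_avg_const)
  also have "2 ^ (card S + card T) * cube_avg n (u (S \<union> T)) =
      2 ^ card (S \<inter> T) * (2 ^ card (S \<union> T) * cube_avg n (u (S \<union> T)))"
    using fin by (subst card_Un_Int) (simp_all add: power_add)
  also have "\<dots> = 2 ^ card (S \<inter> T)"
    using u[of "S \<union> T"] assms by simp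
  finally show ?thesis .
qed

text \<open>With the clique planted, the vector is uniform on a subcube and has density
  \<open>1 + bias S\<close> relative to the uniform distribution. Mixing scales the deviation by
  \<open>card S / n\<close>.\<close>

lemma expectation_planted:
  assumes "S \<subseteq> {1..n}" "n > 0"
  shows "measure_pmf.expectation (planted n S) (\<lambda>x. of_bool (h x)) =
    cube_avg n (\<lambda>x. of_bool (h x)) +
    real (card S) / real n * cube_avg n (\<lambda>x. of_bool (h x) * bias S x)"
proof -
  let ?h = "\<lambda>x. of_bool (h x) :: real"
  let ?C = "{x \<in> cube n. \<forall>i\<in>S. x i}"
  have S: "card S \<le> n"
    using card_mono[OF _ assms(1)] by simp
  have "card ?C \<noteq> 0"
    using card_subcube[OF assms(1)] by (intro notI) simp
  then have C: "finite ?C" "?C \<noteq> {}"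
    using finite_cube[of n] by (auto intro: card_ge_0_finite simp del: Collect_empty_eq)
  \<comment> \<open>A point mass is uniform on a singleton, so every factor is uniform and the
    product is uniform on the product set.\<close>
  have "Pi_pmf {1..n} False (\<lambda>i. if i \<in> S then return_pmf True else bernoulli_pmf (1/2)) =
      Pi_pmf {1..n} False (\<lambda>i. pmf_of_set (if i \<in> S then {True} else UNIV))"
    by (intro Pi_pmf_cong) (auto simp: pmf_of_set_singleton bernoulli_pmf_half_conv_pmf_of_set)
  also have "\<dots> = pmf_of_set ?C"
    unfolding subcube_eq[OF assms(1)] by (intro Pi_pmf_of_set) auto
  finally have planted_eq: "planted n S = bernoulli_pmf (real (card S) / real n) \<bind>
      (\<lambda>b. if b then pmf_of_set ?C else pmf_of_set (cube n))"
    unfolding planted_def by presburger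
  have [simp]: "cube n \<noteq> {}"
    using C by auto
  have card_C: "2 ^ card S / 2 ^ n = 1 / real (card ?C)"
    using arg_cong[OF card_subcube[OF assms(1)], of real] C by (simp add: field_simps)
  have "measure_pmf.expectation (pmf_of_set ?C) ?h = (\<Sum>x\<in>?C. ?h x) / real (card ?C)"
    by (rule integral_pmf_of_set[OF C(2,1)])
  also have "(\<Sum>x\<in>?C. ?h x) = (\<Sum>x\<in>cube n. if \<forall>i\<in>S. x i then ?h x else 0)"
    using finite_cube by (rule sum.inter_filter)
  also have "\<dots> = (\<Sum>x\<in>cube n. ?h x * of_bool (\<forall>i\<in>S. x i))"
    by (rule sum.cong) auto
  also have "\<dots> / real (card ?C) = (2 ^ card S / 2 ^ n) * \<dots>"
    unfolding card_C by simp
  also have "\<dots> = cube_avg n (\<lambda>x. ?h x + ?h x * bias S x)"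
    by (simp add: cube_avg_def bias_def algebra_simps sum_distrib_left sum_divide_distrib)
  also have "\<dots> = cube_avg n ?h + cube_avg n (\<lambda>x. ?h x * bias S x)"
    by (rule cube_avg_add)
  finally have q: "measure_pmf.expectation (pmf_of_set ?C) ?h = \<dots>" .
  have p: "measure_pmf.expectation (pmf_of_set (cube n)) ?h = cube_avg n ?h"
    by (simp add: integral_pmf_of_set finite_cube card_cube cube_avg_def)
  have "measure_pmf.expectation (planted n S) ?h =
      real (card S) / real n * measure_pmf.expectation (pmf_of_set ?C) ?h +
      (1 - real (card S) / real n) * measure_pmf.expectation (pmf_of_set (cube n)) ?h"
    unfolding planted_eq using C S assms(2)
    by (subst pmf_expectation_bind[of UNIV]) (auto simp: finite_cube UNIV_bool)
  also have "\<dots> = cube_avg n ?h + real (card S) / real n * cube_avg n (\<lambda>x. ?h x * bias S x)"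
    unfolding p q by (simp add: algebra_simps)
  finally show ?thesis .
qed

section \<open>Exponential moments of the intersection with a random \<open>k\<close>-set\<close>

lemma power_card_eq_sum_Pow:
  fixes B :: real
  assumes "finite Z"
  shows "B ^ card Z = (\<Sum>J\<in>Pow Z. (B - 1) ^ card J)"
  using prod_add[OF assms, of "\<lambda>_. B - 1" "\<lambda>_. 1"] by simp

text \<open>A random \<open>k\<close>-set contains \<open>j\<close> given elements with probability
  the product of \<open>(k - i) / (n - i)\<close> over \<open>i < j\<close>, and each factor is at
  most \<open>k / n\<close>.\<close>

lemma binomial_diff_le:
  assumes "j \<le> k" "k \<le> n"
  shows "real ((n - j) choose (k - j)) \<le> real (n choose k) * (real k / real n) ^ j"
  using assms(1)
proof (induction j)
  case (Suc j)
  define m l where "m = n - Suc j" and "l = k - Suc j"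
  have ml: "n - j = Suc m" "k - j = Suc l" "l \<le> m"
    using Suc.prems assms by (auto simp: m_def l_def)
  have "real (Suc l) * real (Suc m choose Suc l) = real (Suc m) * real (m choose l)"
    using binomial_absorption[of l "Suc m"] by (metis diff_Suc_1 of_nat_mult)
  then have "real (m choose l) = real (Suc m choose Suc l) * (real (Suc l) / real (Suc m))"
    by (simp add: field_simps del: of_nat_Suc)
  also have "\<dots> \<le> real (Suc m choose Suc l) * (real k / real n)"
  proof (rule mult_left_mono)
    have "real (k - j) * real n \<le> real k * real (n - j)"
      using Suc.prems assms by (simp add: of_nat_diff algebra_simps mult_left_mono)
    moreover have "a / b \<le> c / d" if "a * d \<le> c * b" "b > 0" "d > 0" for a b c d :: real
      using that by (simp add: field_simps)
    ultimately show "real (Suc l) / real (Suc m) \<le> real k / real n"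
      using assms Suc.prems unfolding ml(1,2)[symmetric] by simp
  qed simp
  also have "\<dots> \<le> real (n choose k) * (real k / real n) ^ j * (real k / real n)"
    using Suc ml by (intro mult_right_mono) simp_all
  finally show ?case
    by (simp add: m_def l_def mult_ac)
qed simp

text \<open>Such a \<open>T\<close> is determined by \<open>T - J\<close>, which gives a binomial
  coefficient; if \<open>J\<close> has more than \<open>k\<close> elements, there is no
  \<open>T\<close> at all.\<close>

lemma card_ksubsets_superset_le:
  assumes "J \<subseteq> {1..n}" "k \<le> n"
  shows "real (card {T \<in> ksubsets n k. J \<subseteq> T})
    \<le> real (n choose k) * (real k / real n) ^ card J"
proof (cases "card J \<le> k")
  case True
  let ?R = "{R. R \<subseteq> {1..n} - J \<and> card R = k - card J}"
  have fin: "finite J"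
    using assms(1) by (rule finite_subset) simp
  have "{T \<in> ksubsets n k. J \<subseteq> T} \<subseteq> (\<lambda>R. R \<union> J) ` ?R"
  proof
    fix T assume "T \<in> {T \<in> ksubsets n k. J \<subseteq> T}"
    then have "T = (T - J) \<union> J" "T - J \<in> ?R"
      using fin by (auto simp: ksubsets_def card_Diff_subset)
    then show "T \<in> (\<lambda>R. R \<union> J) ` ?R" by blast
  qed
  moreover have "finite ?R"
    by (rule finite_subset[of _ "Pow {1..n}"]) auto
  ultimately have "card {T \<in> ksubsets n k. J \<subseteq> T} \<le> card ?R"
    by (meson card_image_le card_mono finite_imageI order_trans)
  also have "card ?R = (n - card J) choose (k - card J)"
    using assms(1) fin by (simp add: n_subsets card_Diff_subset)
  finally have "real (card {T \<in> ksubsets n k. J \<subseteq> T}) \<le> real ((n - card J) choose (k - card J))"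
    by (simp only: of_nat_le_iff)
  also have "\<dots> \<le> real (n choose k) * (real k / real n) ^ card J"
    using True assms(2) by (rule binomial_diff_le)
  finally show ?thesis .
next
  case False
  have "card J \<le> k" if "T \<in> ksubsets n k" "J \<subseteq> T" for T
    using that card_mono[of T J] finite_subset[of T "{1..n}"] by (auto simp: ksubsets_def)
  with False have *: "{T \<in> ksubsets n k. J \<subseteq> T} = {}" by blast
  show ?thesis unfolding * by simp
qed

text \<open>Expand \<open>B ^ card (S \<inter> T)\<close> as the sum of
  \<open>(B - 1) ^ card J\<close> over \<open>J \<subseteq> S \<inter> T\<close> and sum over
  \<open>T\<close> first. The containment bound for each \<open>J\<close> lets the sum fold back
  into a power, as if the elements of \<open>S\<close> lay in \<open>T\<close> independently with
  probability \<open>k / n\<close>.\<close>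

lemma sum_power_card_inter_le:
  fixes B :: real
  assumes S: "S \<in> ksubsets n k" and "B \<ge> 1" "k \<le> n"
  shows "(\<Sum>T\<in>ksubsets n k. B ^ card (S \<inter> T))
    \<le> real (n choose k) * (1 + (B - 1) * (real k / real n)) ^ k"
proof -
  have fin: "finite S" and cS: "card S = k" and sub: "S \<subseteq> {1..n}"
    using S finite_subset[of S "{1..n}"] by (auto simp: ksubsets_def)
  have "(\<Sum>T\<in>ksubsets n k. B ^ card (S \<inter> T)) =
      (\<Sum>T\<in>ksubsets n k. \<Sum>J | J \<in> Pow S \<and> J \<subseteq> T. (B - 1) ^ card J)"
    using fin by (intro sum.cong refl, subst power_card_eq_sum_Pow) (auto intro!: sum.cong)
  also have "\<dots> = (\<Sum>J\<in>Pow S. \<Sum>T | T \<in> ksubsets n k \<and> J \<subseteq> T. (B - 1) ^ card J)"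
    using fin finite_ksubsets by (intro sum.swap_restrict) auto
  also have "\<dots> = (\<Sum>J\<in>Pow S. real (card {T \<in> ksubsets n k. J \<subseteq> T}) * (B - 1) ^ card J)"
    by simp
  also have "\<dots> \<le> (\<Sum>J\<in>Pow S. real (n choose k) * (real k / real n) ^ card J * (B - 1) ^ card J)"
    using assms sub by (intro sum_mono mult_right_mono card_ksubsets_superset_le) auto
  also have "\<dots> = real (n choose k) * (\<Sum>J\<in>Pow S. ((B - 1) * (real k / real n)) ^ card J)"
    unfolding sum_distrib_left power_mult_distrib by (simp only: mult_ac)
  also have "\<dots> = real (n choose k) * (1 + (B - 1) * (real k / real n)) ^ k"
    using power_card_eq_sum_Pow[OF fin, of "1 + (B - 1) * (real k / real n)"] cS by simp
  finally show ?thesis .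
qed

section \<open>The sets eliminated by a single query\<close>

lemma expectation_of_bool_bounds:
  "0 \<le> measure_pmf.expectation D (\<lambda>x. of_bool (h x) :: real)"
  "measure_pmf.expectation D (\<lambda>x. of_bool (h x) :: real) \<le> 1"
proof -
  show "0 \<le> measure_pmf.expectation D (\<lambda>x. of_bool (h x) :: real)"
    by simp
  show "measure_pmf.expectation D (\<lambda>x. of_bool (h x) :: real) \<le> 1"
    by (intro measure_pmf.integral_le_const measure_pmf.integrable_const_bound[where B = 1]) auto
qed

lemma cube_avg_of_bool_bounds:
  "0 \<le> cube_avg n (\<lambda>x. of_bool (h x))" "cube_avg n (\<lambda>x. of_bool (h x)) \<le> 1"
  using cube_avg_mono[of "\<lambda>_. 0" "\<lambda>x. of_bool (h x)" n]
    cube_avg_mono[of "\<lambda>x. of_bool (h x)" "\<lambda>_. 1" n]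
  by (simp_all add: cube_avg_const)

text \<open>The mean under \<open>planted n S\<close> is \<open>q = p + l * d\<close> with
  \<open>l = k / n\<close>, and \<open>1 / t\<close> is \<open>r * l\<^sup>2\<close>. An
  inadmissible \<open>p\<close> beats both parts of the tolerance, so
  \<open>r * l < \<bar>d\<bar>\<close> and \<open>r * (q * (1 - q)) < d\<^sup>2\<close>. Passing
  from \<open>q\<close> to \<open>p\<close> costs at most another \<open>d\<^sup>2\<close>, hence
  the factor 2.\<close>

lemma cube_avg_not_in_vstat:
  fixes n :: nat and h :: "(nat \<Rightarrow> bool) \<Rightarrow> bool"
  defines "p \<equiv> cube_avg n (\<lambda>x. of_bool (h x))"
  assumes S: "S \<in> ksubsets n k" and k: "1 \<le> k" "k \<le> n" and "r > 0"
    and out: "p \<notin> vstat ((real n)\<^sup>2 / (r * (real k)\<^sup>2)) (planted n S) h"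
  shows "r * (p * (1 - p)) < 2 * (cube_avg n (\<lambda>x. of_bool (h x) * bias S x))\<^sup>2"
proof -
  define d where "d = cube_avg n (\<lambda>x. of_bool (h x) * bias S x)"
  define l where "l = real k / real n"
  define q where "q = measure_pmf.expectation (planted n S) (\<lambda>x. of_bool (h x) :: real)"
  have l: "l > 0" using k by (simp add: l_def)
  have q: "q = p + l * d"
    using expectation_planted[of S n h] S k by (simp add: ksubsets_def q_def p_def l_def d_def)
  have "1 / ((real n)\<^sup>2 / (r * (real k)\<^sup>2)) = r * l\<^sup>2"
    by (simp add: l_def power_divide)
  moreover have "q * (1 - q) / ((real n)\<^sup>2 / (r * (real k)\<^sup>2)) = q * (1 - q) * (r * l\<^sup>2)"
    by (simp add: l_def power_divide)
  ultimately have "p < q - max (r * l\<^sup>2) (sqrt (q * (1 - q) * (r * l\<^sup>2))) \<or>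
      p > q + max (r * l\<^sup>2) (sqrt (q * (1 - q) * (r * l\<^sup>2)))"
    using out unfolding vstat_def Let_def q_def[symmetric] by auto
  then have "max (r * l\<^sup>2) (sqrt (q * (1 - q) * (r * l\<^sup>2))) < \<bar>l * d\<bar>"
    using q by linarith
  then have 1: "r * l\<^sup>2 < \<bar>l * d\<bar>" and 2: "sqrt (q * (1 - q) * (r * l\<^sup>2)) < \<bar>l * d\<bar>"
    by simp_all
  from 1 have 1: "r * l < \<bar>d\<bar>"
    using l by (simp add: abs_mult power2_eq_square mult.left_commute)
  from 2 have "q * (1 - q) * (r * l\<^sup>2) < \<bar>l * d\<bar>\<^sup>2"
    using real_le_rsqrt[of "\<bar>l * d\<bar>" "q * (1 - q) * (r * l\<^sup>2)"] by linarith
  then have 2: "r * (q * (1 - q)) < d\<^sup>2"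
    using l by (simp add: power_mult_distrib mult_ac)
  \<comment> \<open>The tolerance is stated with the variance at \<open>q\<close>; its \<open>1 / t\<close> part pays for replacing \<open>q\<close> by \<open>p\<close>.\<close>
  have "p * (1 - p) - q * (1 - q) = l * d * (p + q - 1)"
    by (simp add: q algebra_simps)
  also have "\<dots> \<le> \<bar>l * d\<bar> * \<bar>p + q - 1\<bar>"
    by (metis abs_ge_self abs_mult)
  also have "\<dots> \<le> \<bar>l * d\<bar> * 1"
    using expectation_of_bool_bounds[of "planted n S" h, folded q_def]
      cube_avg_of_bool_bounds[of n h, folded p_def]
    by (intro mult_left_mono) linarith+
  finally have "r * (p * (1 - p)) \<le> r * (q * (1 - q) + l * \<bar>d\<bar>)"
    using \<open>r > 0\<close> l by (intro mult_left_mono) (auto simp: abs_mult)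
  also have "\<dots> = r * (q * (1 - q)) + (r * l) * \<bar>d\<bar>"
    by (simp add: algebra_simps)
  also have "\<dots> < d\<^sup>2 + \<bar>d\<bar> * \<bar>d\<bar>"
    using 2 1 by (intro add_less_le_mono mult_right_mono) auto
  finally show ?thesis
    by (simp add: d_def power2_eq_square)
qed

text \<open>Add up the biases with signs that make all correlations with \<open>h\<close>
  nonnegative, and apply Cauchy--Schwarz to the sum. Its mean square is governed by the pairwise
  inner products, and the variance of \<open>h\<close> cancels.\<close>

lemma card_eliminated_second_moment:
  fixes n :: nat and h :: "(nat \<Rightarrow> bool) \<Rightarrow> bool"
  defines "p \<equiv> cube_avg n (\<lambda>x. of_bool (h x))"
  assumes A: "A \<subseteq> Pow {1..n}" and "r > 0"
    and big: "\<And>S. S \<in> A \<Longrightarrow>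
      r * (p * (1 - p)) < 2 * (cube_avg n (\<lambda>x. of_bool (h x) * bias S x))\<^sup>2"
  shows "(real (card A))\<^sup>2 * r \<le> 2 * (\<Sum>S\<in>A. \<Sum>T\<in>A. 2 ^ card (S \<inter> T) - 1)"
proof -
  \<comment> \<open>Centring keeps the correlations, as each \<open>bias S\<close> has mean 0, but
    lowers the mean square from \<open>p\<close> to \<open>p * (1 - p)\<close>.\<close>
  define f where "f x = of_bool (h x) - p" for x
  define V where "V = p * (1 - p)"
  define d where "d S = cube_avg n (\<lambda>x. of_bool (h x) * bias S x)" for S
  have d: "cube_avg n (\<lambda>x. f x * bias S x) = d S" if "S \<in> A" for S
    using cube_avg_bias[of S n] that A
    by (simp add: f_def left_diff_distrib cube_avg_diff cube_avg_cmult d_def subset_iff)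
  have "(f x)\<^sup>2 = of_bool (h x) - 2 * p * of_bool (h x) + p * p" for x
    by (simp add: f_def power2_eq_square algebra_simps)
  then have "cube_avg n (\<lambda>x. (f x)\<^sup>2) = p - 2 * p * p + p * p"
    by (simp add: cube_avg_add cube_avg_diff cube_avg_cmult cube_avg_const flip: p_def)
  then have V: "cube_avg n (\<lambda>x. (f x)\<^sup>2) = V"
    by (simp add: V_def algebra_simps)
  have V0: "V \<ge> 0"
    using cube_avg_of_bool_bounds[of n h] by (simp add: V_def p_def)
  define W where "W x = (\<Sum>S\<in>A. sgn (d S) * bias S x)" for x
  have "cube_avg n (\<lambda>x. f x * W x) = (\<Sum>S\<in>A. cube_avg n (\<lambda>x. sgn (d S) * (f x * bias S x)))"
    unfolding W_def sum_distrib_left cube_avg_sum[symmetric] by (simp add: mult_ac)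
  also have "\<dots> = (\<Sum>S\<in>A. \<bar>d S\<bar>)"
    unfolding cube_avg_cmult using d by (intro sum.cong) (auto simp: abs_sgn mult.commute)
  finally have fW: "cube_avg n (\<lambda>x. f x * W x) = (\<Sum>S\<in>A. \<bar>d S\<bar>)" .
  have "(W x)\<^sup>2 = (\<Sum>S\<in>A. \<Sum>T\<in>A. (sgn (d S) * sgn (d T)) * (bias S x * bias T x))" for x
    by (simp add: W_def power2_eq_square sum_product mult_ac)
  then have "cube_avg n (\<lambda>x. (W x)\<^sup>2) =
      (\<Sum>S\<in>A. \<Sum>T\<in>A. (sgn (d S) * sgn (d T)) * cube_avg n (\<lambda>x. bias S x * bias T x))"
    by (simp add: cube_avg_sum cube_avg_cmult)
  also have "\<dots> = (\<Sum>S\<in>A. \<Sum>T\<in>A. (sgn (d S) * sgn (d T)) * (2 ^ card (S \<inter> T) - 1))"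
    using A by (intro sum.cong refl, subst cube_avg_bias_bias) auto
  \<comment> \<open>The inner products are nonnegative, so replacing the products of signs by 1
    cannot decrease the sum.\<close>
  also have "\<dots> \<le> (\<Sum>S\<in>A. \<Sum>T\<in>A. 1 * (2 ^ card (S \<inter> T) - 1))"
    by (intro sum_mono mult_right_mono) (auto simp: sgn_if)
  finally have WW: "cube_avg n (\<lambda>x. (W x)\<^sup>2) \<le> (\<Sum>S\<in>A. \<Sum>T\<in>A. 2 ^ card (S \<inter> T) - 1)"
    by simp
  have "real (card A) * sqrt (r * V / 2) = (\<Sum>S\<in>A. sqrt (r * V / 2))"
    by simp
  also have "\<dots> \<le> (\<Sum>S\<in>A. \<bar>d S\<bar>)"
  proof (intro sum_mono real_le_lsqrt)
    show "r * V / 2 \<le> \<bar>d S\<bar>\<^sup>2" if "S \<in> A" for S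
      using big[OF that] by (simp add: V_def d_def)
  qed simp
  finally have "(real (card A) * sqrt (r * V / 2))\<^sup>2 \<le> (cube_avg n (\<lambda>x. f x * W x))\<^sup>2"
    using \<open>r > 0\<close> V0 fW by (intro power_mono) auto
  also have "\<dots> \<le> V * cube_avg n (\<lambda>x. (W x)\<^sup>2)"
    using cube_avg_Cauchy_Schwarz[of n f W] V by simp
  also have "\<dots> \<le> V * (\<Sum>S\<in>A. \<Sum>T\<in>A. 2 ^ card (S \<inter> T) - 1)"
    using V0 WW by (rule mult_left_mono[rotated])
  finally have *: "V * ((real (card A))\<^sup>2 * r) \<le> V * (2 * (\<Sum>S\<in>A. \<Sum>T\<in>A. 2 ^ card (S \<inter> T) - 1))"
    using \<open>r > 0\<close> V0 by (simp add: power_mult_distrib mult_ac)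
  show ?thesis
  proof (cases "V = 0")
    case False
    then show ?thesis using * V0 by simp
  next
    case True
    \<comment> \<open>Without variance every correlation vanishes, against the strict inequality in
      \<open>big\<close>.\<close>
    have "A = {}"
    proof (rule ccontr)
      assume "A \<noteq> {}"
      then obtain S where S: "S \<in> A" by blast
      have "(d S)\<^sup>2 \<le> 0"
        using cube_avg_Cauchy_Schwarz[of n f "bias S"] V True d[OF S] by simp
      then show False
        using big[OF S] True unfolding V_def[symmetric] d_def[symmetric] by simp
    qed
    then show ?thesis by simp
  qed
qed

text \<open>A Markov bound: each large term is dominated by
  \<open>2 / b * b\<^sup>2 ^ card (S \<inter> T)\<close>, whose sum over all \<open>T\<close> is a
  bounded moment. The spare factor \<open>1 / b\<close> later absorbs the constants.\<close>

lemma sum_large_inter_le: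
  fixes n :: nat and \<delta> r :: real
  defines "b \<equiv> real n powr \<delta>"
  assumes S: "S \<in> ksubsets n k" and k: "1 \<le> k" "k \<le> n" "real k \<le> real n powr (1/2 - \<delta>)"
    and "\<delta> > 0" "b \<ge> 2" "r \<ge> 1"
  shows "(\<Sum>T | T \<in> ksubsets n k \<and> 2 ^ card (S \<inter> T) - 1 > r / 4. 2 ^ card (S \<inter> T))
      * real n powr (\<delta> / 3 * ln r) \<le> 6 / b * real (n choose k)"
    (is "sum _ ?L * ?Q \<le> _")
proof -
  have n: "real n > 0" using k by simp
  have b: "b > 0" using \<open>b \<ge> 2\<close> by simp
  \<comment> \<open>For \<open>z \<ge> 1\<close> the threshold gives
    \<open>r \<le> 4 * 2 ^ z \<le> 8 ^ z\<close>, so \<open>ln r \<le> 3 * z\<close>; this is the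
    source of the 3 in the exponent \<open>\<delta> / 3 * ln r\<close>.\<close>
  have term_le: "2 ^ z * ?Q \<le> 2 / b * b\<^sup>2 ^ z" if z: "2 ^ z - 1 > r / 4" for z :: nat
  proof -
    have "z \<noteq> 0"
      using z \<open>r \<ge> 1\<close> by (intro notI) simp
    then have "(4::real) \<le> 4 ^ z"
      by (intro self_le_power) auto
    then have "4 * 2 ^ z \<le> (4::real) ^ z * 2 ^ z"
      by (rule mult_right_mono) simp
    then have "r \<le> 4 ^ z * 2 ^ z"
      using z by linarith
    also have "\<dots> = (8::real) ^ z"
      by (simp flip: power_mult_distrib)
    finally have "ln r \<le> ln (8 ^ z)"
      using \<open>r \<ge> 1\<close> by simp
    also have "\<dots> = real z * (3 * ln 2)"
      using ln_realpow[of 2 3] by (simp add: ln_realpow)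
    also have "\<dots> \<le> real z * 3"
      using ln_2_less_1 by (intro mult_left_mono) auto
    finally have "\<delta> / 3 * ln r \<le> \<delta> / 3 * (real z * 3)"
      using \<open>\<delta> > 0\<close> by (intro mult_left_mono) auto
    then have "?Q \<le> real n powr (\<delta> * real z)"
      using n k by (intro powr_mono) auto
    also have "\<dots> = b ^ z"
      using b by (simp add: b_def powr_powr flip: powr_realpow)
    finally have "2 ^ z * ?Q \<le> (2 * b) ^ z"
      by (simp add: power_mult_distrib mult_left_mono)
    also have "2 * b = 2 / b * b\<^sup>2"
      using b by (simp add: power2_eq_square)
    also have "(2 / b * b\<^sup>2) ^ z = (2 / b) ^ z * b\<^sup>2 ^ z"
      by (rule power_mult_distrib)
    \<comment> \<open>As \<open>z \<ge> 1\<close> and \<open>2 / b \<le> 1\<close>, one factor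
      \<open>2 / b\<close> can be kept.\<close>
    also have "\<dots> \<le> (2 / b) ^ 1 * b\<^sup>2 ^ z"
      using \<open>z \<noteq> 0\<close> \<open>b \<ge> 2\<close> by (intro mult_right_mono power_decreasing) auto
    finally show ?thesis by simp
  qed
  \<comment> \<open>The bound on \<open>k\<close> enters here:
    \<open>n powr (2 * \<delta>) * n powr (1 - 2 * \<delta>) = n\<close>.\<close>
  have "b\<^sup>2 * (real k)\<^sup>2 \<le> b\<^sup>2 * (real n powr (1/2 - \<delta>))\<^sup>2"
    using k by (intro mult_left_mono power_mono) auto
  also have "\<dots> = real n"
    using n by (simp add: b_def power2_eq_square flip: powr_add)
  finally have bk: "b\<^sup>2 * (real k)\<^sup>2 \<le> real n" .
  have b2: "b\<^sup>2 \<ge> 1"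
    using \<open>b \<ge> 2\<close> by (simp add: one_le_power)
  \<comment> \<open>By \<open>bk\<close> the total exponent
    \<open>(b\<^sup>2 - 1) * k\<^sup>2 / n\<close> is at most 1.\<close>
  have "(1 + (b\<^sup>2 - 1) * (real k / real n)) ^ k \<le> exp ((b\<^sup>2 - 1) * (real k / real n)) ^ k"
    using b2 by (intro power_mono exp_ge_add_one_self) auto
  also have "\<dots> = exp (real k * ((b\<^sup>2 - 1) * (real k / real n)))"
    by (rule exp_of_nat_mult[symmetric])
  also have "\<dots> \<le> exp 1"
  proof -
    have "(b\<^sup>2 - 1) * (real k)\<^sup>2 \<le> b\<^sup>2 * (real k)\<^sup>2"
      by (intro mult_right_mono) auto
    also note bk
    finally show ?thesis
      using n by (simp add: power2_eq_square field_simps)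
  qed
  also have "\<dots> \<le> 3"
    by (rule exp_le)
  finally have exp3: "(1 + (b\<^sup>2 - 1) * (real k / real n)) ^ k \<le> 3" .
  have "sum (\<lambda>T. 2 ^ card (S \<inter> T)) ?L * ?Q = (\<Sum>T\<in>?L. 2 ^ card (S \<inter> T) * ?Q)"
    by (rule sum_distrib_right)
  also have "\<dots> \<le> (\<Sum>T\<in>?L. 2 / b * b\<^sup>2 ^ card (S \<inter> T))"
    by (intro sum_mono term_le) simp
  also have "\<dots> \<le> (\<Sum>T\<in>ksubsets n k. 2 / b * b\<^sup>2 ^ card (S \<inter> T))"
    using b finite_ksubsets by (intro sum_mono2) auto
  also have "\<dots> = 2 / b * (\<Sum>T\<in>ksubsets n k. b\<^sup>2 ^ card (S \<inter> T))"
    by (simp add: sum_distrib_left)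
  also have "\<dots> \<le> 2 / b * (real (n choose k) * (1 + (b\<^sup>2 - 1) * (real k / real n)) ^ k)"
    using b b2 S k by (intro mult_left_mono sum_power_card_inter_le) auto
  also have "\<dots> \<le> 2 / b * (real (n choose k) * 3)"
    using b exp3 by (intro mult_left_mono) auto
  finally show ?thesis by simp
qed

text \<open>In the second-moment inequality, pairs with
  \<open>2 ^ card (S \<inter> T) - 1 \<le> r / 4\<close> account for at most half of the left-hand
  side. The rare pairs with larger intersection must supply the rest, which bounds the number of
  eliminated sets.\<close>

lemma card_eliminated_le:
  fixes n :: nat and \<delta> r :: real and h :: "(nat \<Rightarrow> bool) \<Rightarrow> bool"
  defines "b \<equiv> real n powr \<delta>"
  assumes k: "1 \<le> k" "k \<le> n" "real k \<le> real n powr (1/2 - \<delta>)"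
    and "\<delta> > 0" "b \<ge> 2" "r \<ge> 1"
  shows "real (card {S \<in> ksubsets n k. cube_avg n (\<lambda>x. of_bool (h x)) \<notin>
      vstat ((real n)\<^sup>2 / (r * (real k)\<^sup>2)) (planted n S) h}) * real n powr (\<delta> / 3 * ln r)
    \<le> 24 / b * real (n choose k)"
    (is "real (card ?A) * ?Q \<le> _")
proof -
  define M where "M = 6 / b * real (n choose k)"
  let ?a = "real (card ?A)"
  have Q: "?Q > 0" using k by simp
  have M: "M \<ge> 0" using \<open>b \<ge> 2\<close> by (simp add: M_def)
  have fin: "finite ?A" using finite_ksubsets by simp
  have sum_le: "(\<Sum>T\<in>?A. 2 ^ card (S \<inter> T) - 1) \<le> ?a * (r / 4) + M / ?Q" if S: "S \<in> ?A" for S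
  proof -
    let ?L = "{T. T \<in> ksubsets n k \<and> 2 ^ card (S \<inter> T) - 1 > r / 4}"
    have "(\<Sum>T\<in>?A. 2 ^ card (S \<inter> T) - 1) \<le>
        (\<Sum>T\<in>?A. r / 4 + (if T \<in> ?L then 2 ^ card (S \<inter> T) else 0))"
      using \<open>r \<ge> 1\<close> by (intro sum_mono) (auto simp: not_less)
    also have "\<dots> = ?a * (r / 4) + (\<Sum>T\<in>?A \<inter> ?L. 2 ^ card (S \<inter> T))"
      using fin unfolding sum.distrib by (simp add: sum.inter_restrict del: mem_Collect_eq)
    also have "(\<Sum>T\<in>?A \<inter> ?L. 2 ^ card (S \<inter> T)) \<le> (\<Sum>T\<in>?L. 2 ^ card (S \<inter> T) :: real)"
      using finite_ksubsets by (intro sum_mono2) auto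
    also have "\<dots> \<le> M / ?Q"
    proof (subst pos_le_divide_eq[OF Q])
      show "(\<Sum>T\<in>?L. 2 ^ card (S \<inter> T)) * ?Q \<le> M"
        unfolding M_def b_def using S assms by (intro sum_large_inter_le) auto
    qed
    finally show ?thesis by simp
  qed
  have "?a\<^sup>2 * r \<le> 2 * (\<Sum>S\<in>?A. \<Sum>T\<in>?A. 2 ^ card (S \<inter> T) - 1)"
  proof (rule card_eliminated_second_moment[where h = h])
    fix S assume "S \<in> ?A"
    then show "r * (cube_avg n (\<lambda>x. of_bool (h x)) * (1 - cube_avg n (\<lambda>x. of_bool (h x))))
        < 2 * (cube_avg n (\<lambda>x. of_bool (h x) * bias S x))\<^sup>2"
      using k \<open>r \<ge> 1\<close> by (intro cube_avg_not_in_vstat[where k = k]) auto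
  qed (use \<open>r \<ge> 1\<close> in \<open>auto simp: ksubsets_def\<close>)
  also have "\<dots> \<le> 2 * (\<Sum>S\<in>?A. ?a * (r / 4) + M / ?Q)"
    by (intro mult_left_mono sum_mono sum_le) auto
  also have "\<dots> = 2 * (?a * (?a * (r / 4) + M / ?Q))"
    by simp
  finally have "?a\<^sup>2 * r \<le> 2 * (?a * (?a * (r / 4) + M / ?Q))" .
  \<comment> \<open>The light pairs contribute \<open>a\<^sup>2 * r / 2\<close>, which is moved to
    the left.\<close>
  moreover have "a * (a * r) \<le> a * (4 * x)" if "a\<^sup>2 * r \<le> 2 * (a * (a * (r / 4) + x))"
    for a x :: real
    using that by (simp add: power2_eq_square algebra_simps)
  ultimately have "?a * (?a * r) \<le> ?a * (4 * (M / ?Q))"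
    by blast
  then have "?a * r \<le> 4 * (M / ?Q)"
  proof (cases "?a = 0")
    case True
    show ?thesis unfolding True using M Q by simp
  next
    case False
    then have "?a > 0" by (simp only: of_nat_0_less_iff of_nat_eq_0_iff neq0_conv)
    with \<open>?a * (?a * r) \<le> _\<close> show ?thesis
      by (rule mult_left_le_imp_le)
  qed
  then have "?a \<le> 4 * M / ?Q"
    using \<open>r \<ge> 1\<close> mult_left_mono[of 1 r ?a] by simp
  then have "?a * ?Q \<le> 4 * M"
    unfolding pos_le_divide_eq[OF Q] .
  also have "4 * M = 24 / b * real (n choose k)"
    by (simp add: M_def)
  finally show ?thesis .
qed

section \<open>The query bound and its consequence for running time\<close>

text \<open>For \<open>r \<ge> 1\<close> a query eliminates at most a fraction
  \<open>1 / (2 * ?Q)\<close> of the sets, so fewer than \<open>?Q\<close> queries leave at least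
  half of them. For \<open>r < 1\<close> the bound \<open>?Q\<close> is at most 1 and a single query
  has to be forced.\<close>

lemma planted_requires_queries:
  assumes k: "1 \<le> k" "real k \<le> real n powr (1/2 - \<delta>)" and "\<delta> > 0" "r > 0"
    and n: "n \<ge> 16" "real n powr \<delta> \<ge> 48"
  shows "requires_queries n k ((real n)\<^sup>2 / (r * (real k)\<^sup>2)) (real n powr (\<delta> / 3 * ln r))"
    (is "requires_queries n k ?t ?Q")
  unfolding requires_queries_def
proof (intro allI impI)
  fix A assume A: "solves n k ?t A"
  have "real k \<le> real n powr (1/2)"
    using k(2) n(1) \<open>\<delta> > 0\<close> by (elim order_trans) (intro powr_mono, auto)
  then have k_sqrt: "real k \<le> sqrt (real n)"
    by (simp add: powr_half_sqrt)
  have sqrt_n: "4 \<le> sqrt (real n)"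
    using n(1) by (intro real_le_rsqrt) simp
  have "real k * 4 \<le> sqrt (real n) * sqrt (real n)"
    using k_sqrt sqrt_n by (intro mult_mono) auto
  then have k4: "real k * 4 \<le> real n"
    by simp
  then have kn: "k \<le> n" by linarith
  \<comment> \<open>Half of the sets must still be two sets, so four are required in all.\<close>
  have "4 \<le> real n / real k"
    using k4 k(1) by (simp add: field_simps)
  also have "\<dots> \<le> (real n / real k) ^ k"
    using k4 k(1) by (intro self_le_power) (auto simp: field_simps)
  also have "\<dots> \<le> real (n choose k)"
    using kn by (rule binomial_ge_n_over_k_pow_k)
  finally have N: "4 \<le> real (n choose k)" .
  have t: "?t > 0"
    using k(1) kn \<open>r > 0\<close> by simp
  \<comment> \<open>The largest integer strictly below \<open>?Q\<close>: more than \<open>q\<close>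
    queries means at least \<open>?Q\<close>. As \<open>?Q > 0\<close>, \<open>nat\<close> does not
    truncate.\<close>
  define q where "q = nat (\<lceil>?Q\<rceil> - 1)"
  have "?Q > 0" using n(1) by simp
  then have q: "real q = of_int \<lceil>?Q\<rceil> - 1"
    by (simp add: q_def)
  have q_less: "real q < ?Q"
    unfolding q by linarith
  \<comment> \<open>For \<open>r < 1\<close> the trivial count suffices, because then
    \<open>?Q \<le> 1\<close> and \<open>q = 0\<close>.\<close>
  define \<beta> where "\<beta> = (if r \<ge> 1 then real (n choose k) / 2 / ?Q else real (n choose k))"
  have "real (card {S \<in> ksubsets n k. cube_avg n (\<lambda>x. of_bool (h x)) \<notin> vstat ?t (planted n S) h})
      \<le> \<beta>" (is "real (card ?B) \<le> _") for h
  proof (cases "r \<ge> 1")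
    case True
    have "real (card ?B) * ?Q \<le> 24 / real n powr \<delta> * real (n choose k)"
      using k kn n True \<open>\<delta> > 0\<close> by (intro card_eliminated_le) auto
    also have "\<dots> \<le> 1 / 2 * real (n choose k)"
      using n(2) by (intro mult_right_mono) (auto simp: divide_simps)
    finally show ?thesis
      using True \<open>?Q > 0\<close> by (simp add: \<beta>_def pos_le_divide_eq)
  next
    case False
    have "card ?B \<le> n choose k"
      unfolding card_ksubsets[symmetric] by (intro card_mono finite_ksubsets) auto
    then show ?thesis using False by (simp add: \<beta>_def)
  qed
  moreover have "real q * \<beta> + 2 \<le> real (card (ksubsets n k))"
  proof (cases "r \<ge> 1")
    case True
    have "real q * \<beta> \<le> ?Q * \<beta>"
      using q_less True by (intro mult_right_mono) (auto simp: \<beta>_def)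
    also have "\<dots> = real (n choose k) / 2"
      using True \<open>?Q > 0\<close> by (simp add: \<beta>_def)
    finally show ?thesis
      using N by (simp add: card_ksubsets)
  next
    case False
    then have "\<delta> / 3 * ln r \<le> 0"
      using \<open>r > 0\<close> \<open>\<delta> > 0\<close> by (intro mult_nonneg_nonpos) auto
    then have "?Q \<le> real n powr 0"
      using n(1) by (intro powr_mono) auto
    then have "q = 0"
      using q_less n(1) by simp
    then show ?thesis
      using N by (simp add: card_ksubsets)
  qed
  ultimately obtain S v m where "S \<in> ksubsets n k" "permitted ?t (planted n S) A v"
      "q < snd (config v A m)"
    using adversary_forces_queries[OF t A, of "\<lambda>h. cube_avg n (\<lambda>x. of_bool (h x))" \<beta> q] by blast
  moreover from this(3) have "?Q \<le> real (snd (config v A m))"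
    using q by linarith
  ultimately show "\<exists>S\<in>ksubsets n k. \<exists>v. permitted ?t (planted n S) A v \<and>
      (\<exists>m. ?Q \<le> real (snd (config v A m)))"
    by blast
qed

text \<open>Each step poses at most one query, and the counter is frozen once a set has been
  output.\<close>

lemma runs_in_time_imp_queries_le:
  assumes "runs_in_time n k t A T" "S \<in> ksubsets n k" "permitted t (planted n S) A v"
  shows "snd (config v A m) \<le> T"
proof -
  obtain m' R q where m': "m' \<le> T" "config v A m' = (Output R, q)"
    using assms unfolding runs_in_time_def by blast
  have "snd (config v A m) \<le> snd (config v A (max m m'))"
    by (intro snd_config_mono) simp
  also have "\<dots> = snd (config v A m')"
    using config_Output_stable[OF m'(2), of "max m m'"] m'(2) by simp
  also have "\<dots> \<le> T"
    using snd_config_le[of v A m'] m'(1) by simp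
  finally show ?thesis .
qed

theorem theorem2p7:
  fixes \<delta> :: real
  assumes "\<delta> > 0"
  shows
    "(\<exists>c>0. \<forall>\<^sub>F n in sequentially. \<forall>(k::nat) (r::real).
        1 \<le> k \<and> real k \<le> real n powr (1/2 - \<delta>) \<and> r > 0 \<longrightarrow>
        requires_queries n k ((real n)\<^sup>2 / (r * (real k)\<^sup>2)) (real n powr (c * ln r)))
   \<and> (\<forall>(k :: nat \<Rightarrow> nat) (t :: nat \<Rightarrow> real) (A :: nat \<Rightarrow> stat_alg).
        (\<forall>\<^sub>F n in sequentially. 1 \<le> k n \<and> real (k n) \<le> real n powr (1/2 - \<delta>)) \<and>
        (\<forall>\<^sub>F n in sequentially. t n > 0) \<and>
        t \<in> o(\<lambda>n. (real n)\<^sup>2 / (real (k n))\<^sup>2) \<and>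
        polynomial_time k t A \<longrightarrow>
        (\<forall>\<^sub>F n in sequentially. \<not> solves n (k n) (t n) (A n)))
   \<and> (\<exists>c>0. \<forall>\<^sub>F n in sequentially. \<forall>k::nat.
        1 \<le> k \<and> real k \<le> real n powr (1/2 - \<delta>) \<longrightarrow>
        requires_queries n k (real n powr (2 - \<delta>) / (real k)\<^sup>2) (real n powr (c * ln (real n))))"
proof (intro conjI allI impI)
  \<comment> \<open>The constant 48 makes \<open>24 / n powr \<delta>\<close> at most 1/2.\<close>
  have "\<forall>\<^sub>F n in sequentially. 48 powr (1 / \<delta>) \<le> real n"
    using filterlim_real_sequentially by (simp add: filterlim_at_top)
  then have "\<forall>\<^sub>F n in sequentially. real n powr \<delta> \<ge> 48"
  proof eventually_elim
    case (elim n)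
    then have "(48 powr (1 / \<delta>)) powr \<delta> \<le> real n powr \<delta>"
      using \<open>\<delta> > 0\<close> by (intro powr_mono2) auto
    then show ?case
      using \<open>\<delta> > 0\<close> by (simp add: powr_powr)
  qed
  then have large: "\<forall>\<^sub>F n in sequentially. n \<ge> 16 \<and> real n powr \<delta> \<ge> 48"
    using eventually_ge_at_top[of "16::nat"] by eventually_elim simp
  show "\<exists>c>0. \<forall>\<^sub>F n in sequentially. \<forall>(k::nat) (r::real).
      1 \<le> k \<and> real k \<le> real n powr (1/2 - \<delta>) \<and> r > 0 \<longrightarrow>
      requires_queries n k ((real n)\<^sup>2 / (r * (real k)\<^sup>2)) (real n powr (c * ln r))"
    using \<open>\<delta> > 0\<close> large
    by (intro exI[of _ "\<delta> / 3"] conjI eventually_mono[OF large] allI impI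
        planted_requires_queries) auto
  show "\<exists>c>0. \<forall>\<^sub>F n in sequentially. \<forall>k::nat.
      1 \<le> k \<and> real k \<le> real n powr (1/2 - \<delta>) \<longrightarrow>
      requires_queries n k (real n powr (2 - \<delta>) / (real k)\<^sup>2) (real n powr (c * ln (real n)))"
  proof (intro exI[of _ "\<delta>\<^sup>2 / 3"] conjI)
    show "\<forall>\<^sub>F n in sequentially. \<forall>k::nat.
      1 \<le> k \<and> real k \<le> real n powr (1/2 - \<delta>) \<longrightarrow>
      requires_queries n k (real n powr (2 - \<delta>) / (real k)\<^sup>2)
        (real n powr (\<delta>\<^sup>2 / 3 * ln (real n)))"
      using large
    proof eventually_elim
      case (elim n)
      then have n: "real n > 0" by simp
      show ?case
      proof (intro allI impI)
        fix k :: nat assume k: "1 \<le> k \<and> real k \<le> real n powr (1/2 - \<delta>)"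
        \<comment> \<open>The choice \<open>r = n powr \<delta>\<close>; its logarithm supplies the
          second \<delta> in the constant \<open>\<delta>\<^sup>2 / 3\<close>.\<close>
        have "requires_queries n k ((real n)\<^sup>2 / (real n powr \<delta> * (real k)\<^sup>2))
            (real n powr (\<delta> / 3 * ln (real n powr \<delta>)))"
          using elim \<open>\<delta> > 0\<close> k n by (intro planted_requires_queries) auto
        moreover have t: "(real n)\<^sup>2 / (real n powr \<delta> * (real k)\<^sup>2) =
            real n powr (2 - \<delta>) / (real k)\<^sup>2"
          using n by (simp add: powr_diff)
        moreover have Q: "\<delta> / 3 * ln (real n powr \<delta>) = \<delta>\<^sup>2 / 3 * ln (real n)"
          using n by (simp add: ln_powr power2_eq_square)
        ultimately show "requires_queries n k (real n powr (2 - \<delta>) / (real k)\<^sup>2)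
            (real n powr (\<delta>\<^sup>2 / 3 * ln (real n)))"
          unfolding t Q by blast
      qed
    qed
  qed (use \<open>\<delta> > 0\<close> in simp)
  fix k :: "nat \<Rightarrow> nat" and t :: "nat \<Rightarrow> real" and A :: "nat \<Rightarrow> stat_alg"
  assume asm: "(\<forall>\<^sub>F n in sequentially. 1 \<le> k n \<and> real (k n) \<le> real n powr (1/2 - \<delta>)) \<and>
        (\<forall>\<^sub>F n in sequentially. t n > 0) \<and>
        t \<in> o(\<lambda>n. (real n)\<^sup>2 / (real (k n))\<^sup>2) \<and>
        polynomial_time k t A"
  then obtain d where d: "\<forall>\<^sub>F n in sequentially. runs_in_time n (k n) (t n) (A n) (n ^ d)"
    unfolding polynomial_time_def by blast
  \<comment> \<open>Once \<open>t\<close> is below this fraction of \<open>n\<^sup>2 / k\<^sup>2\<close>, the bound of the first part exceeds \<open>n ^ d\<close>.\<close>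
  define \<epsilon> where "\<epsilon> = exp (- (3 * (real d + 1) / \<delta>))"
  have "\<forall>\<^sub>F n in sequentially. norm (t n) \<le> \<epsilon> * norm ((real n)\<^sup>2 / (real (k n))\<^sup>2)"
    using asm by (intro landau_o.smallD) (auto simp: \<epsilon>_def)
  moreover have "\<forall>\<^sub>F n in sequentially. 1 \<le> k n \<and> real (k n) \<le> real n powr (1/2 - \<delta>)"
      "\<forall>\<^sub>F n in sequentially. t n > 0"
    using asm by simp_all
  ultimately show "\<forall>\<^sub>F n in sequentially. \<not> solves n (k n) (t n) (A n)"
    using large d
  proof eventually_elim
    case (elim n)
    \<comment> \<open>With this \<open>r\<close> the oracle parameter of the general bound is
      exactly \<open>t n\<close>.\<close>
    define r where "r = (real n)\<^sup>2 / (t n * (real (k n))\<^sup>2)"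
    have pos: "real n > 0" "real (k n) > 0" "t n > 0"
      using elim by auto
    have r: "r > 0"
      using pos by (simp add: r_def)
    have t: "(real n)\<^sup>2 / (r * (real (k n))\<^sup>2) = t n"
      using pos by (simp add: r_def)
    have "t n \<le> \<epsilon> * ((real n)\<^sup>2 / (real (k n))\<^sup>2)"
      using elim by simp
    then have "1 / \<epsilon> \<le> r"
      using pos by (simp add: r_def \<epsilon>_def field_simps)
    then have "exp (3 * (real d + 1) / \<delta>) \<le> r"
      by (simp add: \<epsilon>_def exp_minus field_simps)
    then have "3 * (real d + 1) / \<delta> \<le> ln r"
      using r by (simp add: ln_ge_iff)
    then have "real d + 1 \<le> \<delta> / 3 * ln r"
      using \<open>\<delta> > 0\<close> by (simp add: field_simps)
    then have "real n powr (real d + 1) \<le> real n powr (\<delta> / 3 * ln r)"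
      using elim by (intro powr_mono) auto
    \<comment> \<open>The extra 1 in the exponent makes the comparison with \<open>n ^ d\<close>
      strict.\<close>
    moreover have "real n powr (real d + 1) > real n ^ d"
      using elim pos by (simp add: powr_add powr_realpow)
    ultimately have Q: "real (n ^ d) < real n powr (\<delta> / 3 * ln r)"
      by simp
    show ?case
    proof
      assume "solves n (k n) (t n) (A n)"
      moreover have "requires_queries n (k n) (t n) (real n powr (\<delta> / 3 * ln r))"
        using planted_requires_queries[of "k n" n \<delta> r] elim r \<open>\<delta> > 0\<close> t by simp
      ultimately obtain S v m where "S \<in> ksubsets n (k n)" "permitted (t n) (planted n S) (A n) v"
          "real n powr (\<delta> / 3 * ln r) \<le> real (snd (config v (A n) m))"
        unfolding requires_queries_def by blast
      moreover from this(1,2) have "snd (config v (A n) m) \<le> n ^ d"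
        using elim by (intro runs_in_time_imp_queries_le) auto
      ultimately show False
        using Q by (meson not_less of_nat_le_iff order_trans)
    qed
  qed
qed

end
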